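(* Let $n,p,m\ge 1$, let $\mathbf{X}$ be a nonzero real $n\times p$ matrix with rows $\mathbf{x}_1^T,\dots,\mathbf{x}_n^T$ ($\mathbf{x}_\ell\in\mathbb{R}^p$), let $\mathbf{y}\in\mathbb{R}^n$, $\mu_1\in\mathbb{R}^p$, let $\Sigma_1$ be a $p\times p$ symmetric positive definite matrix, let $\mathbf{R}$ be a real $m\times p$ matrix and $\mathbf{b}\in\mathbb{R}^m$, and assume that $\Omega=\{\beta\in\mathbb{R}^p:\mathbf{R}\beta\ge\mathbf{b}\}$ (componentwise inequality) has positive Lebesgue measure. Let $\Psi:\mathbb{R}\to\mathbb{R}$ be a twice differentiable convex function with $\Psi''(v)>0$ for all $v\in\mathbb{R}$, and assume that $\Psi$ is bounded below by $0$, i.e. $\Psi(v)\ge 0$ for all $v\in\mathbb{R}$. Put $$q(\beta)=\exp\Big\{\mathbf{y}^T\mathbf{X}\beta-\tfrac12(\beta-\mu_1)^T\Sigma_1^{-1}(\beta-\mu_1)\Big\}\,\mathbb{I}(\mathbf{R}\beta\ge\mathbf{b}),\qquad g_\ell(\beta)=e^{-\Psi(\mathbf{x}_\ell^T\beta)},\quad \ell=1,\dots,n,$$ and consider the joint (un-normalized) posterior density $$\pi(\beta,\mathbf{u})= q(\beta)\prod_{\ell=1}^n \mathbb{I}\big(0<u_\ell\le g_\ell(\beta)\big),\qquad \beta\in\mathbb{R}^p,\ \mathbf{u}=(u_1,\dots,u_n)\in(0,\infty)^n .$$ Then the product slice sampler corresponding to $\pi(\beta,\mathbf{u})$ is uniformly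 ergodic, with geometric rate of convergence $r$ satisfying $r\le 1-h$, where $$h=\frac{\displaystyle\int q(\beta)\prod_{\ell=1}^n\frac{g_\ell(\beta)}{\sup_{\beta'\in\mathbb{R}^p}g_\ell(\beta')}\,d\beta}{\displaystyle\int q(\beta)\,d\beta}<1 .$$ That is, $h<1$, and there exist a constant $V>0$ and $r\in(0,1)$ with $r\le 1-h$ such that, for all $N\ge 1$, $$\sup_{\xi\in\Omega}\big\|P^N(\xi,\cdot)-\pi(\cdot)\big\|\le V r^N,$$ where $P$ is the transition kernel of the product slice sampler on $\Omega$, $\pi(\cdot)$ is the posterior probability distribution on $\Omega$ with density proportional to $q(\beta)\prod_{\ell=1}^n g_\ell(\beta)$, and $\|\cdot\|$ is the total variation norm.
   Context: Product slice sampler: the Gibbs sampler for the joint density $\pi(\beta,\mathbf{u})$ which retains only the $\beta$-component. It is the Markov chain on $\Omega$ in which, from the current state $\beta\in\Omega$, one transition consists of: (i) drawing $u_1,\dots,u_n$ independently with $u_\ell\sim\mathrm{Uniform}(0,g_\ell(\beta))$; (ii) drawing the new state $\beta'$ from the conditional distribution of $\beta$ given $\mathbf{u}$, i.e. from the probability distribution with density proportional to $q(\beta')\,\mathbb{I}\big(g_\ell(\beta')\ge u_\ell,\ \ell=1,\dots,n\big)$ (a normal distribution with mean $\mu_1+\Sigma_1\mathbf{X}^T\mathbf{y}$ and covariance $\Sigma_1$, truncated to the set where $\mathbf{R}\beta'\ge\mathbf{b}$ and $\Psi(\mathbf{x}_\ell^T\beta')\le-\log u_\ell$ for all $\ell$).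 $P(\xi,\cdot)$ denotes the resulting one-step transition kernel and $P^N$ its $N$-step iterate. The $\beta$-marginal of the normalized $\pi(\beta,\mathbf{u})$ is the posterior distribution $\pi(\cdot)$, with density proportional to $q(\beta)\prod_{\ell=1}^n g_\ell(\beta)$; it is the invariant distribution of $P$. Uniform (geometric) ergodicity: a Markov chain on a state space $\mathbb{S}$ with transition kernel $P$ and invariant distribution $\pi$ is uniformly geometrically ergodic if there exist $V>0$ and $r\in(0,1)$ with $\sup_{\xi\in\mathbb{S}}\|P^N(\xi,\cdot)-\pi(\cdot)\|\le V r^N$ for all $N$, where $\|\cdot\|$ is the total variation norm; $r$ is called the rate of convergence. *)

theory Defs
  imports "HOL-Probability.Probability"
begin

definition pos_def_matrix :: "real^'p^'p \<Rightarrow> bool" where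
  "pos_def_matrix A \<longleftrightarrow> transpose A = A \<and> (\<forall>v. v \<noteq> 0 \<longrightarrow> 0 < v \<bullet> (A *v v))"

definition feasible_set :: "real^'p^'m \<Rightarrow> real^'m \<Rightarrow> (real^'p) set" where
  "feasible_set R b = {\<beta>. \<forall>i. b $ i \<le> (R *v \<beta>) $ i}"

definition q_factor ::
  "real^'p^'n \<Rightarrow> real^'n \<Rightarrow> real^'p \<Rightarrow> real^'p^'p \<Rightarrow> real^'p^'m \<Rightarrow> real^'m \<Rightarrow> real^'p \<Rightarrow> real" where
  "q_factor X y \<mu>1 \<Sigma>1 R b \<beta> =
     exp (y \<bullet> (X *v \<beta>) - 1 / 2 * ((\<beta> - \<mu>1) \<bullet> (matrix_inv \<Sigma>1 *v (\<beta> - \<mu>1))))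
     * indicator (feasible_set R b) \<beta>"

definition g_factor :: "(real \<Rightarrow> real) \<Rightarrow> real^'p^'n \<Rightarrow> 'n \<Rightarrow> real^'p \<Rightarrow> real" where
  "g_factor \<Psi> X l \<beta> = exp (- \<Psi> (row l X \<bullet> \<beta>))"

definition joint_density :: "('a \<Rightarrow> real) \<Rightarrow> ('n::finite \<Rightarrow> 'a \<Rightarrow> real) \<Rightarrow> 'a \<Rightarrow> ('n \<Rightarrow> real) \<Rightarrow> real" where
  "joint_density q g \<beta> u = q \<beta> * (\<Prod>l\<in>UNIV. indicator {0<..g l \<beta>} (u l))"

lemma joint_density_pos:
  assumes "\<And>l. 0 < u l"
  shows "joint_density q g \<beta> u = q \<beta> * indicator {\<beta>'. \<forall>l. u l \<le> g l \<beta>'} \<beta>"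
proof (cases "\<forall>l. u l \<le> g l \<beta>")
  case True
  then show ?thesis using assms by (simp add: joint_density_def)
next
  case False
  then obtain l where "\<not> u l \<le> g l \<beta>" by blast
  then have "(\<Prod>l\<in>UNIV. indicator {0<..g l \<beta>} (u l)) = (0::real)"
    by (intro prod_zero bexI[of _ l]) auto
  then show ?thesis using False by (simp add: joint_density_def)
qed

text \<open>The probability measure with density proportional to \<open>f\<close> with respect to \<open>M\<close>.  It is the
  null measure if \<open>f\<close> integrates to 0.\<close>

definition normalized_density :: "'a measure \<Rightarrow> ('a \<Rightarrow> real) \<Rightarrow> 'a measure" where
  "normalized_density M f = density M (\<lambda>x. ennreal (f x / (\<integral>z. f z \<partial>M)))"

text \<open>One transition from \<open>\<xi>\<close>: draw the \<open>u l\<close> independently and uniformly on \<open>(0, g l \<xi>)\<close>, then draw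
  the new state from the conditional distribution given \<open>u\<close>.  The measure \<open>S\<close> is both the reference
  measure for the densities and, through its sigma-algebra, the state space.  Values of \<open>u\<close> for
  which the conditional density integrates to 0 are irrelevant.\<close>

definition slice_kernel ::
  "'a measure \<Rightarrow> ('a \<Rightarrow> real) \<Rightarrow> ('n::finite \<Rightarrow> 'a \<Rightarrow> real) \<Rightarrow> 'a \<Rightarrow> 'a measure" where
  "slice_kernel S q g \<xi> =
     (\<Pi>\<^sub>M l\<in>UNIV. uniform_measure lborel {0<..<g l \<xi>})
       \<bind> (\<lambda>u. normalized_density S (\<lambda>\<beta>'. joint_density q g \<beta>' u))"

definition posterior :: "'a measure \<Rightarrow> ('a \<Rightarrow> real) \<Rightarrow> ('n::finite \<Rightarrow> 'a \<Rightarrow> real) \<Rightarrow> 'a measure" where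
  "posterior S q g = normalized_density S (\<lambda>\<beta>. q \<beta> * (\<Prod>l\<in>UNIV. g l \<beta>))"

primrec kernel_iterate :: "'a measure \<Rightarrow> ('a \<Rightarrow> 'a measure) \<Rightarrow> nat \<Rightarrow> 'a \<Rightarrow> 'a measure" where
  "kernel_iterate S P 0 = return S"
| "kernel_iterate S P (Suc N) = (\<lambda>\<xi>. kernel_iterate S P N \<xi> \<bind> P)"

text \<open>The total variation norm of \<open>\<mu> - \<nu>\<close>, in the normalization in which it is at most 1 for
  probability measures.\<close>

definition tv_dist :: "'a measure \<Rightarrow> 'a measure \<Rightarrow> real" where
  "tv_dist \<mu> \<nu> = (SUP A\<in>sets \<mu>. \<bar>measure \<mu> A - measure \<nu> A\<bar>)"

text \<open>The first three conjuncts state that \<open>P\<close> is a Markov kernel on \<open>S\<close> with invariant distribution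
  \<open>\<pi>\<close>; the remaining ones are uniform geometric ergodicity with rate \<open>r\<close>.\<close>

definition uniformly_ergodic :: "'a measure \<Rightarrow> ('a \<Rightarrow> 'a measure) \<Rightarrow> 'a measure \<Rightarrow> real \<Rightarrow> bool" where
  "uniformly_ergodic S P \<pi> r \<longleftrightarrow>
     P \<in> S \<rightarrow>\<^sub>M prob_algebra S \<and> \<pi> \<in> space (prob_algebra S) \<and> \<pi> \<bind> P = \<pi> \<and>
     0 < r \<and> r < 1 \<and>
     (\<exists>V>0. \<forall>N\<ge>1. (SUP \<xi>\<in>space S. tv_dist (kernel_iterate S P N \<xi>) \<pi>) \<le> V * r ^ N)"

definition h_const :: "('a::euclidean_space \<Rightarrow> real) \<Rightarrow> ('n::finite \<Rightarrow> 'a \<Rightarrow> real) \<Rightarrow> real" where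
  "h_const q g =
     (\<integral>\<beta>. q \<beta> * (\<Prod>l\<in>UNIV. g l \<beta> / (SUP \<beta>'. g l \<beta>')) \<partial>lborel) / (\<integral>\<beta>. q \<beta> \<partial>lborel)"

end

theory Submission
  imports Defs
begin

text \<open>
  Write \<open>w \<xi> u\<close> for the density of the auxiliary variables drawn from the state \<open>\<xi>\<close> and \<open>j x u\<close> for the
  joint density. The transition density from \<open>\<xi>\<close> to \<open>x\<close> is the integral over \<open>u\<close> of
  \<open>w \<xi> u * j x u / mass u\<close>, where \<open>mass u\<close> is the integral of \<open>j x u\<close> over \<open>x\<close> and is at most the
  integral of \<open>q\<close>. The integral over \<open>u\<close> of \<open>w \<xi> u * j x u\<close> equals
  \<open>q x * (\<Prod>l. min (g l \<xi>) (g l x) / g l \<xi>)\<close>, which dominates \<open>q x * (\<Prod>l. g l x / sup (g l))\<close>.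
  Hence the kernel dominates \<open>h\<close> times the posterior, whatever \<open>\<xi>\<close> is, and Doeblin's argument gives
  the rate \<open>1 - h\<close>. Equality \<open>h = 1\<close> would force almost every feasible point to minimize
  \<open>\<Psi>\<close> along a nonzero row of \<open>X\<close>, hence to lie on a single hyperplane.
\<close>

subsection \<open>Doeblin's condition\<close>

lemma kernel_iterate_measurable:
  assumes "P \<in> S \<rightarrow>\<^sub>M prob_algebra S"
  shows "kernel_iterate S P N \<in> S \<rightarrow>\<^sub>M prob_algebra S"
  by (induction N) (use assms in \<open>auto intro!: measurable_bind_prob_space\<close>)

text \<open>Since \<open>P x A - h * \<pi> A\<close> is nonnegative, its integral against the law after \<open>N\<close> steps is at least
  \<open>1 - (1 - h) ^ N\<close> times its integral against \<open>\<pi>\<close>, and the latter is known by invariance.\<close>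

lemma emeasure_kernel_iterate_ge:
  assumes P: "P \<in> S \<rightarrow>\<^sub>M prob_algebra S" and \<pi>: "\<pi> \<in> space (prob_algebra S)"
    and inv: "\<pi> \<bind> P = \<pi>" and h: "0 \<le> h" "h \<le> 1"
    and minor: "\<And>\<xi> A. \<xi> \<in> space S \<Longrightarrow> A \<in> sets S \<Longrightarrow> ennreal h * emeasure \<pi> A \<le> emeasure (P \<xi>) A"
    and \<xi>: "\<xi> \<in> space S" and A: "A \<in> sets S"
  shows "ennreal (1 - (1 - h) ^ N) * emeasure \<pi> A \<le> emeasure (kernel_iterate S P N \<xi>) A"
  using A
proof (induction N arbitrary: A)
  case 0
  then show ?case by simp
next
  case (Suc N)
  define c where "c = 1 - (1 - h) ^ N"
  have c: "0 \<le> c" "c \<le> 1" using h by (auto simp: c_def power_le_one)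
  let ?\<mu> = "kernel_iterate S P N \<xi>"
  have \<mu>: "?\<mu> \<in> space (prob_algebra S)"
    using kernel_iterate_measurable[OF P] \<xi> by (rule measurable_space)
  interpret \<mu>: prob_space ?\<mu> using \<mu> by (simp add: space_prob_algebra)
  interpret \<pi>: prob_space \<pi> using \<pi> by (simp add: space_prob_algebra)
  have sets [measurable_cong]: "sets ?\<mu> = sets S" "sets \<pi> = sets S"
    using \<mu> \<pi> by (auto simp: space_prob_algebra)
  have [simp]: "space ?\<mu> = space S" "space \<pi> = space S"
    using sets by (auto dest: sets_eq_imp_space_eq)
  note [measurable] = Suc.prems
  have Psub [measurable]: "P \<in> S \<rightarrow>\<^sub>M subprob_algebra S"
    using P by (rule measurable_prob_algebraD)
  have meas [measurable]: "(\<lambda>x. emeasure (P x) A) \<in> borel_measurable S"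
    by measurable
  define a where "a = ennreal h * emeasure \<pi> A"
  define \<rho> where "\<rho> x = emeasure (P x) A - a" for x
  have \<rho> [measurable]: "\<rho> \<in> borel_measurable S" unfolding \<rho>_def by measurable
  have split: "emeasure (P x) A = a + \<rho> x" if "x \<in> space S" for x
    using minor[OF that Suc.prems] by (simp add: \<rho>_def a_def add_diff_inverse_ennreal)
  have bind_eq: "emeasure (\<nu> \<bind> P) A = a + (\<integral>\<^sup>+x. \<rho> x \<partial>\<nu>)"
    if "\<nu> \<in> space (prob_algebra S)" for \<nu>
  proof -
    interpret \<nu>: prob_space \<nu> using that by (simp add: space_prob_algebra)
    have [measurable_cong]: "sets \<nu> = sets S" using that by (simp add: space_prob_algebra)
    then have [simp]: "space \<nu> = space S" by (rule sets_eq_imp_space_eq)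
    have "emeasure (\<nu> \<bind> P) A = (\<integral>\<^sup>+x. a + \<rho> x \<partial>\<nu>)"
      unfolding emeasure_bind_prob_algebra[OF that P Suc.prems]
      by (intro nn_integral_cong) (simp add: split)
    also have "\<dots> = a + (\<integral>\<^sup>+x. \<rho> x \<partial>\<nu>)"
      by (subst nn_integral_add) (auto simp: \<nu>.emeasure_space_1[simplified])
    finally show ?thesis .
  qed
  \<comment> \<open>The induction hypothesis covers all measurable sets at once, so it is an
    inequality of measures and passes to the integral of \<open>\<rho>\<close>.\<close>
  have "scale_measure (ennreal c) \<pi> \<le> ?\<mu>"
    using Suc.IH by (subst le_measure) (auto simp: sets c_def emeasure_notin_sets intro: Suc.IH)
  then have "ennreal c * (\<integral>\<^sup>+x. \<rho> x \<partial>\<pi>) \<le> (\<integral>\<^sup>+x. \<rho> x \<partial>?\<mu>)"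
    using nn_integral_mono_measure[of "scale_measure (ennreal c) \<pi>" ?\<mu> \<rho>]
    by (simp add: sets nn_integral_scale_measure)
  then have step: "a + ennreal c * (\<integral>\<^sup>+x. \<rho> x \<partial>\<pi>) \<le> emeasure (kernel_iterate S P (Suc N) \<xi>) A"
    using bind_eq[OF \<mu>] by simp
  have eq: "a + (\<integral>\<^sup>+x. \<rho> x \<partial>\<pi>) = emeasure \<pi> A"
    using bind_eq[OF \<pi>] inv by simp
  have ha: "a = ennreal (h * measure \<pi> A)"
    using h by (simp add: a_def \<pi>.emeasure_eq_measure ennreal_mult)
  have int\<rho>: "(\<integral>\<^sup>+x. \<rho> x \<partial>\<pi>) = ennreal ((1 - h) * measure \<pi> A)"
  proof -
    have "(\<integral>\<^sup>+x. \<rho> x \<partial>\<pi>) = emeasure \<pi> A - a"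
      using eq by (metis ennreal_add_diff_cancel_left ha ennreal_neq_top infinity_ennreal_def)
    then show ?thesis using h
      by (simp add: ha \<pi>.emeasure_eq_measure ennreal_minus algebra_simps)
  qed
  \<comment> \<open>The weights satisfy 1 - (1 - h)^(N+1) = h + c (1 - h): the h comes from
    \<open>a\<close>, and the 1 - h from the integral of \<open>\<rho>\<close> against
    \<open>\<pi>\<close>.\<close>
  have "ennreal (1 - (1 - h) ^ Suc N) * emeasure \<pi> A = a + ennreal c * (\<integral>\<^sup>+x. \<rho> x \<partial>\<pi>)"
  proof -
    have "1 - (1 - h) ^ Suc N = h + c * (1 - h)" by (simp add: c_def algebra_simps)
    then show ?thesis using h c
      by (simp add: ha int\<rho> \<pi>.emeasure_eq_measure flip: ennreal_mult ennreal_plus)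
         (simp add: algebra_simps)
  qed
  with step show ?case by simp
qed

text \<open>The lower bound by c = 1 - (1 - h)^N applied to a set limits how far its measure can
  fall below that of \<open>\<pi>\<close>; applied to the complement, it limits how far it can rise
  above.\<close>

lemma tv_dist_kernel_iterate_le:
  assumes P: "P \<in> S \<rightarrow>\<^sub>M prob_algebra S" and \<pi>: "\<pi> \<in> space (prob_algebra S)"
    and inv: "\<pi> \<bind> P = \<pi>" and h: "0 \<le> h" "h \<le> 1"
    and minor: "\<And>\<xi> A. \<xi> \<in> space S \<Longrightarrow> A \<in> sets S \<Longrightarrow> ennreal h * emeasure \<pi> A \<le> emeasure (P \<xi>) A"
    and \<xi>: "\<xi> \<in> space S"
  shows "tv_dist (kernel_iterate S P N \<xi>) \<pi> \<le> (1 - h) ^ N"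
proof -
  define c where "c = 1 - (1 - h) ^ N"
  have c: "0 \<le> c" "c \<le> 1" using h by (auto simp: c_def power_le_one)
  let ?\<mu> = "kernel_iterate S P N \<xi>"
  have \<mu>: "?\<mu> \<in> space (prob_algebra S)"
    using kernel_iterate_measurable[OF P] \<xi> by (rule measurable_space)
  interpret \<mu>: prob_space ?\<mu> using \<mu> by (simp add: space_prob_algebra)
  interpret \<pi>: prob_space \<pi> using \<pi> by (simp add: space_prob_algebra)
  have sets: "sets ?\<mu> = sets S" "sets \<pi> = sets S"
    using \<mu> \<pi> by (auto simp: space_prob_algebra)
  have sp: "space ?\<mu> = space S" "space \<pi> = space S"
    using sets by (auto dest: sets_eq_imp_space_eq)
  have ge: "c * measure \<pi> A \<le> measure ?\<mu> A" if "A \<in> sets S" for A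
  proof -
    have "ennreal c * emeasure \<pi> A \<le> emeasure ?\<mu> A"
      unfolding c_def by (rule emeasure_kernel_iterate_ge) (use assms that in auto)
    then show ?thesis
      using c by (simp add: \<pi>.emeasure_eq_measure \<mu>.emeasure_eq_measure ennreal_mult[symmetric])
  qed
  have "\<bar>measure ?\<mu> A - measure \<pi> A\<bar> \<le> 1 - c" if A: "A \<in> sets S" for A
  proof -
    have "c * measure \<pi> (space S - A) \<le> measure ?\<mu> (space S - A)" using A by (intro ge) auto
    then have "c * (1 - measure \<pi> A) \<le> 1 - measure ?\<mu> A"
      using \<mu>.prob_compl[of A] \<pi>.prob_compl[of A] A by (simp add: sets sp)
    moreover have "(1 - c) * measure \<pi> A \<le> 1 - c" "0 \<le> (1 - c) * measure \<pi> A"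
      using c by (auto simp: mult_left_le)
    ultimately show ?thesis using ge[OF A] by (auto simp: algebra_simps abs_le_iff)
  qed
  then show ?thesis
    unfolding tv_dist_def by (intro cSUP_least) (auto simp: sets c_def)
qed

lemma uniformly_ergodic_of_minorization:
  assumes "P \<in> S \<rightarrow>\<^sub>M prob_algebra S" and "\<pi> \<in> space (prob_algebra S)"
    and "\<pi> \<bind> P = \<pi>" and "0 < h" "h < 1"
    and "\<And>\<xi> A. \<xi> \<in> space S \<Longrightarrow> A \<in> sets S \<Longrightarrow> ennreal h * emeasure \<pi> A \<le> emeasure (P \<xi>) A"
  shows "uniformly_ergodic S P \<pi> (1 - h)"
proof -
  interpret prob_space \<pi> using assms(2) by (simp add: space_prob_algebra)
  have "space S \<noteq> {}"
    using not_empty assms(2) by (auto simp: space_prob_algebra dest: sets_eq_imp_space_eq)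
  \<comment> \<open>A nonempty state space lets the supremum be bounded pointwise. The constant 1
    becomes the witness for \<open>V\<close>.\<close>
  then have "(SUP \<xi>\<in>space S. tv_dist (kernel_iterate S P N \<xi>) \<pi>) \<le> 1 * (1 - h) ^ N" for N
    using assms by (intro cSUP_least) (auto intro!: tv_dist_kernel_iterate_le)
  then show ?thesis
    using assms unfolding uniformly_ergodic_def by (auto intro!: exI[of _ 1])
qed

subsection \<open>The slice sampler for general factors\<close>

text \<open>Writing the auxiliary law as a density against product Lebesgue measure makes Tonelli
  available for \<open>u\<close>. The half-open intervals are chosen to match those in
  \<open>joint_density\<close>. The two measures are compared on boxes, where both
  factorize.\<close>

lemma PiM_uniform_measure:
  fixes a :: "'n::finite \<Rightarrow> real"
  assumes a: "\<And>l. 0 < a l"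
  shows "(\<Pi>\<^sub>M l\<in>UNIV. uniform_measure lborel {0<..<a l}) =
    density (\<Pi>\<^sub>M l\<in>(UNIV :: 'n set). lborel) (\<lambda>u. ennreal (\<Prod>l\<in>UNIV. indicator {0<..a l} (u l) / a l))"
    (is "_ = density ?L ?w")
proof -
  have prob: "prob_space (uniform_measure lborel {0<..<a l})" for l
    using a[of l] by (intro prob_space_uniform_measure) auto
  interpret U: product_prob_space "\<lambda>l. uniform_measure lborel {0<..<a l}" "UNIV :: 'n set"
    using prob by (rule product_prob_spaceI)
  interpret L: product_sigma_finite "\<lambda>_::'n. lborel :: real measure" by unfold_locales
  have [simp]: "sets (\<Pi>\<^sub>M l\<in>UNIV. uniform_measure lborel {0<..<a l}) = sets ?L"
    by (intro sets_PiM_cong) auto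
  have w [measurable]: "?w \<in> borel_measurable ?L" by measurable
  have "density ?L ?w = (\<Pi>\<^sub>M l\<in>UNIV. uniform_measure lborel {0<..<a l})"
  proof (rule U.PiM_eqI)
    fix A :: "'n \<Rightarrow> real set"
    assume "\<And>l. l \<in> UNIV \<Longrightarrow> A l \<in> sets (uniform_measure lborel {0<..<a l})"
    then have A [measurable]: "A l \<in> sets borel" for l by auto
    have comp: "(\<integral>\<^sup>+x. ennreal (indicator {0<..a l} x / a l) * indicator (A l) x \<partial>lborel)
        = emeasure (uniform_measure lborel {0<..<a l}) (A l)" for l
    proof -
      \<comment> \<open>The open and the half-open interval differ only in the null set {a
        l}.\<close>
      have "(\<integral>\<^sup>+x. ennreal (indicator {0<..a l} x / a l) * indicator (A l) x \<partial>lborel)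
          = (\<integral>\<^sup>+x. ennreal (1 / a l) * indicator ({0<..<a l} \<inter> A l) x \<partial>lborel)"
        using AE_lborel_singleton[of "a l"]
        by (intro nn_integral_cong_AE) (auto elim!: eventually_mono split: split_indicator)
      also have "\<dots> = ennreal (1 / a l) * emeasure lborel ({0<..<a l} \<inter> A l)"
        by (subst nn_integral_cmult_indicator) auto
      also have "\<dots> = emeasure (uniform_measure lborel {0<..<a l}) (A l)"
        using a[of l]
        by (simp add: divide_ennreal_def inverse_ennreal mult.commute inverse_eq_divide)
      finally show ?thesis .
    qed
    have "emeasure (density ?L ?w) (Pi\<^sub>E UNIV A)
        = (\<integral>\<^sup>+u. ?w u * indicator (Pi\<^sub>E UNIV A) u \<partial>?L)"
      by (intro emeasure_density) auto
    also have "\<dots> = (\<integral>\<^sup>+u. (\<Prod>l\<in>UNIV. ennreal (indicator {0<..a l} (u l) / a l) * indicator (A l) (u l)) \<partial>?L)"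
    proof (intro nn_integral_cong)
      fix u :: "'n \<Rightarrow> real"
      have "indicator (Pi\<^sub>E UNIV A) u = (\<Prod>l\<in>UNIV. indicator (A l) (u l) :: ennreal)"
        by (auto simp: indicator_def PiE_iff prod_zero_iff)
      moreover have "?w u = (\<Prod>l\<in>UNIV. ennreal (indicator {0<..a l} (u l) / a l))"
        using a by (subst prod_ennreal) (auto simp: less_imp_le)
      ultimately show "?w u * indicator (Pi\<^sub>E UNIV A) u
          = (\<Prod>l\<in>UNIV. ennreal (indicator {0<..a l} (u l) / a l) * indicator (A l) (u l))"
        by (simp add: prod.distrib)
    qed
    also have "\<dots> = (\<Prod>l\<in>UNIV. emeasure (uniform_measure lborel {0<..<a l}) (A l))"
      by (subst L.product_nn_integral_prod) (auto simp: comp)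
    finally show "emeasure (density ?L ?w) (Pi\<^sub>E UNIV A)
        = (\<Prod>l\<in>UNIV. emeasure (uniform_measure lborel {0<..<a l}) (A l))" .
  qed auto
  then show ?thesis by simp
qed

text \<open>The \<open>G l\<close> are arbitrary upper bounds, so they may be suprema over a larger
  set than the state space. The strict inequality \<open>u l < g l \<xi>\<close> in
  \<open>slice_pos\<close> keeps clear of the top level of a factor, where a slice can shrink to a
  null set.\<close>

locale slice_sampler = sigma_finite_measure S for S :: "'a measure" +
  fixes q :: "'a \<Rightarrow> real" and g :: "'n::finite \<Rightarrow> 'a \<Rightarrow> real" and G :: "'n \<Rightarrow> real"
  assumes nonempty: "space S \<noteq> {}"
    and q_nonneg: "\<And>x. 0 \<le> q x" and q_integrable: "integrable S q"
    and g_pos: "\<And>l x. 0 < g l x" and g_le: "\<And>l x. g l x \<le> G l"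
    and g_measurable [measurable]: "\<And>l. g l \<in> borel_measurable S"
    and slice_pos: "\<And>\<xi> u. \<xi> \<in> space S \<Longrightarrow> (\<And>l. 0 < u l \<and> u l < g l \<xi>) \<Longrightarrow>
      0 < (\<integral>x. joint_density q g x u \<partial>S)"
begin

abbreviation L :: "('n \<Rightarrow> real) measure" where "L \<equiv> \<Pi>\<^sub>M l\<in>UNIV. lborel"
abbreviation aux_law :: "'a \<Rightarrow> ('n \<Rightarrow> real) measure" where
  "aux_law \<xi> \<equiv> \<Pi>\<^sub>M l\<in>UNIV. uniform_measure lborel {0<..<g l \<xi>}"
abbreviation aux_density :: "'a \<Rightarrow> ('n \<Rightarrow> real) \<Rightarrow> real" where
  "aux_density \<xi> u \<equiv> \<Prod>l\<in>UNIV. indicator {0<..g l \<xi>} (u l) / g l \<xi>"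
abbreviation conditional :: "('n \<Rightarrow> real) \<Rightarrow> 'a measure" where
  "conditional u \<equiv> normalized_density S (\<lambda>x. joint_density q g x u)"
abbreviation mass :: "('n \<Rightarrow> real) \<Rightarrow> real" where
  "mass u \<equiv> \<integral>x. joint_density q g x u \<partial>S"

lemma q_measurable [measurable]: "q \<in> borel_measurable S"
  using q_integrable by auto

lemma g_nonneg: "0 \<le> g l x" using g_pos[of l x] by simp

lemma g_neq_0 [simp]: "g l x \<noteq> 0" using g_pos[of l x] by simp

lemma G_pos: "0 < G l" using g_pos[of l] g_le[of l] by (metis less_le_trans)

lemma prod_g_pos: "0 < (\<Prod>l\<in>UNIV. g l x)" by (simp add: prod_pos g_pos)

lemma space_L [simp]: "space L = UNIV"
  by (simp add: space_PiM PiE_UNIV_domain)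

sublocale L: product_sigma_finite "\<lambda>_::'n. lborel :: real measure" by unfold_locales

sublocale L: sigma_finite_measure L by (rule L.sigma_finite) simp

sublocale SL: pair_sigma_finite S L ..

section \<open>Measurability and normalization of the conditional law\<close>

lemma slice_indicator_measurable [measurable]:
  "(\<lambda>p. indicator {0<..g l (fst p)} (snd p l) :: real) \<in> borel_measurable (S \<Otimes>\<^sub>M L)"
proof -
  have [measurable]: "(\<lambda>p. snd p l) \<in> borel_measurable (S \<Otimes>\<^sub>M L)"
    using measurable_compose[OF measurable_snd, of "\<lambda>u. u l" L borel S] by measurable
  have [measurable]: "(\<lambda>p. g l (fst p)) \<in> borel_measurable (S \<Otimes>\<^sub>M L)"
    by (rule measurable_compose[OF measurable_fst g_measurable])
  show ?thesis
    unfolding indicator_def greaterThanAtMost_iff by measurable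
qed

lemma joint_density_measurable [measurable]:
  "(\<lambda>(x, u). joint_density q g x u) \<in> borel_measurable (S \<Otimes>\<^sub>M L)"
  unfolding joint_density_def split_beta' by measurable

lemma joint_density_measurable1 [measurable]:
  "(\<lambda>x. joint_density q g x u) \<in> borel_measurable S"
  unfolding joint_density_def indicator_def greaterThanAtMost_iff by measurable

lemma aux_density_measurable [measurable]:
  "(\<lambda>(x, u). aux_density x u) \<in> borel_measurable (S \<Otimes>\<^sub>M L)"
proof -
  have [measurable]: "(\<lambda>p. g l (fst p)) \<in> borel_measurable (S \<Otimes>\<^sub>M L)" for l
    by (rule measurable_compose[OF measurable_fst g_measurable])
  show ?thesis unfolding split_beta' by measurable
qed

lemma aux_density_measurable2 [measurable]:
  "aux_density x \<in> borel_measurable L"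
  unfolding indicator_def greaterThanAtMost_iff by measurable

lemma aux_density_nonneg: "0 \<le> aux_density x u"
  by (intro prod_nonneg) (auto simp: g_nonneg)

lemma joint_density_nonneg: "0 \<le> joint_density q g x u"
  by (auto simp: joint_density_def q_nonneg intro!: mult_nonneg_nonneg prod_nonneg)

lemma joint_density_le: "joint_density q g x u \<le> q x"
  unfolding joint_density_def
  by (intro mult_right_le_one_le prod_nonneg prod_le_1 q_nonneg) (auto split: split_indicator)

lemma joint_density_integrable: "integrable S (\<lambda>x. joint_density q g x u)"
  by (rule Bochner_Integration.integrable_bound[OF q_integrable])
     (auto simp: joint_density_nonneg joint_density_le q_nonneg)

lemma mass_nonneg: "0 \<le> mass u"
  by (simp add: joint_density_nonneg)

lemma mass_le: "mass u \<le> (\<integral>x. q x \<partial>S)"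
  by (intro integral_mono joint_density_integrable q_integrable joint_density_le)

lemma ennreal_mass: "ennreal (mass u) = (\<integral>\<^sup>+x. joint_density q g x u \<partial>S)"
  by (simp add: nn_integral_eq_integral joint_density_integrable joint_density_nonneg)

lemma sets_conditional [simp, measurable_cong]: "sets (conditional u) = sets S"
  by (simp add: normalized_density_def)

lemma emeasure_conditional:
  assumes "A \<in> sets S"
  shows "emeasure (conditional u) A
    = (\<integral>\<^sup>+x. ennreal (joint_density q g x u / mass u) * indicator A x \<partial>S)"
  unfolding normalized_density_def using assms by (intro emeasure_density) auto

text \<open>Clearing the denominator yields an identity valid for every \<open>u\<close>: if the
  mass is 0, the joint density vanishes almost everywhere and both sides are 0. Later computations
  therefore need no case distinction on the slice.\<close>

lemma emeasure_conditional_mult_mass: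
  assumes [measurable]: "A \<in> sets S"
  shows "emeasure (conditional u) A * ennreal (mass u)
    = (\<integral>\<^sup>+x. ennreal (joint_density q g x u) * indicator A x \<partial>S)"
proof (cases "mass u = 0")
  case True
  then have "AE x in S. joint_density q g x u = 0"
    using integral_nonneg_eq_0_iff_AE[OF joint_density_integrable] by (simp add: joint_density_nonneg)
  then have "(\<integral>\<^sup>+x. ennreal (joint_density q g x u) * indicator A x \<partial>S) = (\<integral>\<^sup>+x. 0 \<partial>S)"
    by (intro nn_integral_cong_AE) auto
  then show ?thesis using True by simp
next
  case False
  then have "0 < mass u" using mass_nonneg[of u] by simp
  then have "ennreal (joint_density q g x u / mass u) * indicator A x * ennreal (mass u)
      = ennreal (joint_density q g x u) * indicator A x" for x
    by (auto split: split_indicator simp: joint_density_nonneg simp flip: ennreal_mult)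
  then show ?thesis
    by (subst emeasure_conditional[OF assms], subst nn_integral_multc[symmetric]) auto
qed

text \<open>Division by 0 gives 0, so a slice of zero mass carries the null measure. This is why
  \<open>conditional\<close> is at first only a kernel into subprobabilities.\<close>

lemma emeasure_conditional_space:
  "mass u > 0 \<Longrightarrow> emeasure (conditional u) (space S) = 1"
  "mass u = 0 \<Longrightarrow> emeasure (conditional u) (space S) = 0"
proof -
  assume "mass u > 0"
  then have "emeasure (conditional u) (space S)
      = (\<integral>\<^sup>+x. ennreal (joint_density q g x u / mass u) \<partial>S)"
    by (subst emeasure_conditional) (auto intro!: nn_integral_cong)
  also have "\<dots> = 1" using \<open>mass u > 0\<close>
    by (subst nn_integral_eq_integral) (auto simp: joint_density_integrable joint_density_nonneg)
  finally show "emeasure (conditional u) (space S) = 1" .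
qed (simp add: emeasure_conditional)

lemma conditional_measurable [measurable]: "conditional \<in> L \<rightarrow>\<^sub>M subprob_algebra S"
proof (rule measurable_subprob_algebra)
  fix u
  have "emeasure (conditional u) (space S) \<le> 1"
    using emeasure_conditional_space[of u] mass_nonneg[of u] by (cases "mass u = 0") auto
  then show "subprob_space (conditional u)"
    using nonempty by (intro subprob_spaceI) (auto simp: normalized_density_def)
next
  fix A assume [measurable]: "A \<in> sets S"
  have "(\<lambda>u. \<integral>\<^sup>+x. ennreal (joint_density q g x u / mass u) * indicator A x \<partial>S) \<in> borel_measurable L"
    by measurable
  then show "(\<lambda>u. emeasure (conditional u) A) \<in> borel_measurable L"
    by (simp add: emeasure_conditional)
qed simp

section \<open>The auxiliary law and the transition kernel\<close>

lemma aux_law_eq: "aux_law \<xi> = density L (\<lambda>u. ennreal (aux_density \<xi> u))"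
  by (rule PiM_uniform_measure) (rule g_pos)

lemma sets_aux_law [simp, measurable_cong]: "sets (aux_law \<xi>) = sets L"
  by (simp add: aux_law_eq)

lemma conditional_measurable_aux_law: "conditional \<in> aux_law \<xi> \<rightarrow>\<^sub>M subprob_algebra S"
  using conditional_measurable by (simp only: measurable_cong_sets[OF sets_aux_law refl])

lemma prob_space_uniform: "prob_space (uniform_measure lborel {0<..<g l \<xi>})"
  using g_pos[of l \<xi>] by (intro prob_space_uniform_measure) auto

lemma prob_space_aux_law: "prob_space (aux_law \<xi>)"
  by (intro prob_space_PiM prob_space_uniform)

lemma aux_law_measurable [measurable]: "aux_law \<in> S \<rightarrow>\<^sub>M subprob_algebra L"
proof (rule measurable_subprob_algebra)
  fix A assume A [measurable]: "A \<in> sets L"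
  have "(\<lambda>\<xi>. \<integral>\<^sup>+u. ennreal (aux_density \<xi> u) * indicator A u \<partial>L) \<in> borel_measurable S"
    by measurable
  then show "(\<lambda>\<xi>. emeasure (aux_law \<xi>) A) \<in> borel_measurable S"
    unfolding aux_law_eq by (simp add: emeasure_density A)
qed (simp_all add: prob_space_imp_subprob_space prob_space_aux_law)

text \<open>Uniform draws lie strictly inside their intervals almost surely, which is where
  \<open>slice_pos\<close> applies. It follows that the degenerate slices do not cost the transition
  kernel any mass.\<close>

lemma AE_aux_law_mass_pos:
  assumes "\<xi> \<in> space S"
  shows "AE u in aux_law \<xi>. 0 < mass u"
proof -
  have "AE u in aux_law \<xi>. 0 < u l \<and> u l < g l \<xi>" for l
    by (rule AE_PiM_component[where P = "\<lambda>t. 0 < t \<and> t < g l \<xi>"])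
       (auto simp: prob_space_uniform intro!: AE_uniform_measureI)
  then have "AE u in aux_law \<xi>. \<forall>l. 0 < u l \<and> u l < g l \<xi>"
    by (simp add: AE_all_countable)
  then show ?thesis
    by eventually_elim (auto intro!: slice_pos assms)
qed

lemma emeasure_slice_kernel:
  assumes A [measurable]: "A \<in> sets S"
  shows "emeasure (slice_kernel S q g \<xi>) A
    = (\<integral>\<^sup>+u. ennreal (aux_density \<xi> u) * emeasure (conditional u) A \<partial>L)"
proof -
  have "emeasure (slice_kernel S q g \<xi>) A = (\<integral>\<^sup>+u. emeasure (conditional u) A \<partial>aux_law \<xi>)"
    unfolding slice_kernel_def
    by (rule emeasure_bind[OF prob_space.not_empty[OF prob_space_aux_law] conditional_measurable_aux_law A])
  then show ?thesis
    unfolding aux_law_eq by (simp add: nn_integral_density)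
qed

lemma slice_kernel_measurable: "slice_kernel S q g \<in> S \<rightarrow>\<^sub>M prob_algebra S"
proof (rule measurable_prob_algebraI)
  show "slice_kernel S q g \<in> S \<rightarrow>\<^sub>M subprob_algebra S"
    unfolding slice_kernel_def by measurable
next
  fix \<xi> assume \<xi>: "\<xi> \<in> space S"
  note c = conditional_measurable_aux_law[of \<xi>]
  interpret prob_space "aux_law \<xi>" by (rule prob_space_aux_law)
  have "space (slice_kernel S q g \<xi>) = space S"
    unfolding slice_kernel_def by (rule space_bind_measurable[OF c not_empty])
  then have "emeasure (slice_kernel S q g \<xi>) (space (slice_kernel S q g \<xi>))
      = (\<integral>\<^sup>+u. emeasure (conditional u) (space S) \<partial>aux_law \<xi>)"
    unfolding slice_kernel_def by (simp add: emeasure_bind[OF not_empty c])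
  also have "\<dots> = (\<integral>\<^sup>+u. 1 \<partial>aux_law \<xi>)"
    using AE_aux_law_mass_pos[OF \<xi>]
    by (intro nn_integral_cong_AE) (auto elim!: eventually_mono simp: emeasure_conditional_space)
  also have "\<dots> = 1" by (simp add: emeasure_space_1)
  finally show "prob_space (slice_kernel S q g \<xi>)" by (rule prob_spaceI)
qed

section \<open>The posterior and its invariance\<close>

lemma prod_g_integrable: "integrable S (\<lambda>x. q x * (\<Prod>l\<in>UNIV. g l x))"
proof (rule Bochner_Integration.integrable_bound)
  show "integrable S (\<lambda>x. (\<Prod>l\<in>UNIV. G l) * q x)" using q_integrable by simp
  show "AE x in S. norm (q x * (\<Prod>l\<in>UNIV. g l x)) \<le> norm ((\<Prod>l\<in>UNIV. G l) * q x)"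
  proof (rule AE_I2)
    fix x
    have "(\<Prod>l\<in>UNIV. g l x) \<le> (\<Prod>l\<in>UNIV. G l)"
      by (intro prod_mono) (simp add: g_le g_nonneg)
    then show "norm (q x * (\<Prod>l\<in>UNIV. g l x)) \<le> norm ((\<Prod>l\<in>UNIV. G l) * q x)"
      using q_nonneg[of x] prod_g_pos[of x]
      by (simp add: abs_mult mult.commute mult_left_mono)
  qed
qed simp

text \<open>At half the height of the factors at some \<xi> the slice has positive mass, and on that
  slice every factor is at least \<open>u l\<close>. So the posterior density dominates a positive
  multiple of the joint density at \<open>u\<close>.\<close>

lemma posterior_constant_pos: "0 < (\<integral>x. q x * (\<Prod>l\<in>UNIV. g l x) \<partial>S)"
proof -
  obtain \<xi> where \<xi>: "\<xi> \<in> space S" using nonempty by blast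
  define u where "u l = g l \<xi> / 2" for l
  have u: "0 < u l \<and> u l < g l \<xi>" for l using g_pos[of l \<xi>] by (simp add: u_def)
  have "0 < (\<Prod>l\<in>UNIV. u l) * mass u"
    using slice_pos[OF \<xi> u] u by (simp add: prod_pos)
  also have "\<dots> = (\<integral>x. (\<Prod>l\<in>UNIV. u l) * joint_density q g x u \<partial>S)" by simp
  also have "\<dots> \<le> (\<integral>x. q x * (\<Prod>l\<in>UNIV. g l x) \<partial>S)"
  proof (intro integral_mono prod_g_integrable)
    fix x
    have "(\<Prod>l\<in>UNIV. u l * indicator {0<..g l x} (u l)) \<le> (\<Prod>l\<in>UNIV. g l x)"
      using u by (intro prod_mono) (auto split: split_indicator simp: g_nonneg less_imp_le)
    then show "(\<Prod>l\<in>UNIV. u l) * joint_density q g x u \<le> q x * (\<Prod>l\<in>UNIV. g l x)"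
      by (simp add: joint_density_def prod.distrib mult.left_commute mult_left_mono q_nonneg)
  qed (simp add: joint_density_integrable)
  finally show ?thesis .
qed

lemma posterior_eq: "posterior S q g
    = density S (\<lambda>x. ennreal (q x * (\<Prod>l\<in>UNIV. g l x) / (\<integral>z. q z * (\<Prod>l\<in>UNIV. g l z) \<partial>S)))"
  by (simp add: posterior_def normalized_density_def)

lemma emeasure_posterior:
  assumes "A \<in> sets S"
  shows "emeasure (posterior S q g) A
    = (\<integral>\<^sup>+x. ennreal (q x * (\<Prod>l\<in>UNIV. g l x) / (\<integral>z. q z * (\<Prod>l\<in>UNIV. g l z) \<partial>S)) * indicator A x \<partial>S)"
  unfolding posterior_eq using assms by (intro emeasure_density) auto

lemma sets_posterior [simp, measurable_cong]: "sets (posterior S q g) = sets S"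
  by (simp add: posterior_eq)

lemma posterior_in_prob_algebra: "posterior S q g \<in> space (prob_algebra S)"
proof -
  have "emeasure (posterior S q g) (space S) = 1"
    using posterior_constant_pos
    by (subst emeasure_posterior, simp, subst nn_integral_cong[where v = "\<lambda>x. ennreal (q x * (\<Prod>l\<in>UNIV. g l x) / (\<integral>z. q z * (\<Prod>l\<in>UNIV. g l z) \<partial>S))"])
       (auto simp: nn_integral_eq_integral prod_g_integrable q_nonneg prod_nonneg g_nonneg)
  moreover have "space (posterior S q g) = space S"
    by (rule sets_eq_imp_space_eq) simp
  ultimately show ?thesis
    by (auto simp: space_prob_algebra intro: prob_spaceI)
qed

lemma nn_integral_indicator_prod:
  assumes "\<And>l. 0 \<le> a l"
  shows "(\<integral>\<^sup>+u. ennreal (\<Prod>l\<in>UNIV. indicator {0<..a l} (u l)) \<partial>L) = ennreal (\<Prod>l\<in>UNIV. a l)"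
proof -
  have "(\<integral>\<^sup>+u. ennreal (\<Prod>l\<in>UNIV. indicator {0<..a l} (u l)) \<partial>L)
      = (\<integral>\<^sup>+u. (\<Prod>l\<in>UNIV. indicator {0<..a l} (u l)) \<partial>L)"
    by (intro nn_integral_cong) (simp add: ennreal_indicator flip: prod_ennreal)
  also have "\<dots> = (\<Prod>l\<in>UNIV. ennreal (a l))"
    using assms by (subst L.product_nn_integral_prod) auto
  also have "\<dots> = ennreal (\<Prod>l\<in>UNIV. a l)" using assms by (simp add: prod_ennreal)
  finally show ?thesis .
qed

text \<open>Under the joint law of a posterior draw \<open>\<xi>\<close> and its auxiliary variables \<open>u\<close>, the conditional law
  of \<open>\<xi>\<close> given \<open>u\<close> is exactly the one that the second half of the transition draws from.\<close>

lemma posterior_invariant: "posterior S q g \<bind> slice_kernel S q g = posterior S q g"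
proof (rule measure_eqI)
  note K = slice_kernel_measurable and P = posterior_in_prob_algebra
  show sets: "sets (posterior S q g \<bind> slice_kernel S q g) = sets (posterior S q g)"
    using sets_bind'[OF P K] by simp
  fix A assume "A \<in> sets (posterior S q g \<bind> slice_kernel S q g)"
  then have A [measurable]: "A \<in> sets S" by (simp add: sets)
  define C where "C = (\<integral>x. q x * (\<Prod>l\<in>UNIV. g l x) \<partial>S)"
  have C: "0 < C" using posterior_constant_pos by (simp add: C_def)
  have [measurable]: "slice_kernel S q g \<in> S \<rightarrow>\<^sub>M subprob_algebra S"
    using K by (rule measurable_prob_algebraD)
  \<comment> \<open>The factors of the posterior cancel the normalizations 1 / g of the uniform
    laws.\<close>
  have joint: "q x * (\<Prod>l\<in>UNIV. g l x) / C * aux_density x u = joint_density q g x u / C" for x u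
    using prod_g_pos[of x] by (simp add: joint_density_def prod_dividef)
  have "emeasure (posterior S q g \<bind> slice_kernel S q g) A
      = (\<integral>\<^sup>+x. emeasure (slice_kernel S q g x) A \<partial>posterior S q g)"
    by (rule emeasure_bind_prob_algebra[OF P K A])
  also have "\<dots> = (\<integral>\<^sup>+x. ennreal (q x * (\<Prod>l\<in>UNIV. g l x) / C)
      * (\<integral>\<^sup>+u. ennreal (aux_density x u) * emeasure (conditional u) A \<partial>L) \<partial>S)"
    unfolding posterior_eq C_def[symmetric]
    by (subst nn_integral_density) (auto simp: emeasure_slice_kernel)
  also have "\<dots> = (\<integral>\<^sup>+x. \<integral>\<^sup>+u. ennreal (joint_density q g x u / C) * emeasure (conditional u) A \<partial>L \<partial>S)"
  proof (rule nn_integral_cong)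
    fix x
    have "ennreal (joint_density q g x u / C)
        = ennreal (q x * (\<Prod>l\<in>UNIV. g l x) / C) * ennreal (aux_density x u)" for u
      unfolding joint[symmetric] using C aux_density_nonneg
      by (intro ennreal_mult) (auto simp: q_nonneg prod_nonneg g_nonneg)
    then show "ennreal (q x * (\<Prod>l\<in>UNIV. g l x) / C)
        * (\<integral>\<^sup>+u. ennreal (aux_density x u) * emeasure (conditional u) A \<partial>L)
      = (\<integral>\<^sup>+u. ennreal (joint_density q g x u / C) * emeasure (conditional u) A \<partial>L)"
      by (subst nn_integral_cmult[symmetric]) (auto simp: mult.assoc)
  qed
  \<comment> \<open>Integrating out the old state first produces \<open>mass u\<close>, which then
    cancels the normalization of the conditional law.\<close>
  also have "\<dots> = (\<integral>\<^sup>+u. \<integral>\<^sup>+x. ennreal (joint_density q g x u / C) * emeasure (conditional u) A \<partial>S \<partial>L)"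
    by (rule SL.Fubini'[symmetric]) measurable
  also have "\<dots> = (\<integral>\<^sup>+u. ennreal (1 / C) * (emeasure (conditional u) A * ennreal (mass u)) \<partial>L)"
  proof (rule nn_integral_cong)
    fix u
    have "(\<integral>\<^sup>+x. ennreal (joint_density q g x u / C) * emeasure (conditional u) A \<partial>S)
        = (\<integral>\<^sup>+x. ennreal (1 / C) * emeasure (conditional u) A * ennreal (joint_density q g x u) \<partial>S)"
      using C by (intro nn_integral_cong)
        (simp add: joint_density_nonneg divide_inverse ennreal_mult mult_ac)
    also have "\<dots> = ennreal (1 / C) * (emeasure (conditional u) A * ennreal (mass u))"
      by (subst nn_integral_cmult) (auto simp: ennreal_mass mult.assoc)
    finally show "(\<integral>\<^sup>+x. ennreal (joint_density q g x u / C) * emeasure (conditional u) A \<partial>S)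
        = ennreal (1 / C) * (emeasure (conditional u) A * ennreal (mass u))" .
  qed
  also have "\<dots> = (\<integral>\<^sup>+u. \<integral>\<^sup>+x. ennreal (1 / C) * (ennreal (joint_density q g x u) * indicator A x) \<partial>S \<partial>L)"
    unfolding emeasure_conditional_mult_mass[OF A]
    by (intro nn_integral_cong nn_integral_cmult[symmetric]) measurable
  also have "\<dots> = (\<integral>\<^sup>+x. \<integral>\<^sup>+u. ennreal (1 / C) * (ennreal (joint_density q g x u) * indicator A x) \<partial>L \<partial>S)"
    by (rule SL.Fubini') measurable
  \<comment> \<open>Here \<open>x\<close> is the new state. Integrating out \<open>u\<close> gives
    the volume of the box with sides \<open>g l x\<close>, which restores the posterior
    density.\<close>
  also have "\<dots> = (\<integral>\<^sup>+x. ennreal (q x * (\<Prod>l\<in>UNIV. g l x) / C) * indicator A x \<partial>S)"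
  proof (rule nn_integral_cong)
    fix x
    have "(\<integral>\<^sup>+u. ennreal (1 / C) * (ennreal (joint_density q g x u) * indicator A x) \<partial>L)
        = (\<integral>\<^sup>+u. ennreal (q x / C) * indicator A x
            * ennreal (\<Prod>l\<in>UNIV. indicator {0<..g l x} (u l)) \<partial>L)"
      using C by (intro nn_integral_cong)
        (simp add: joint_density_def q_nonneg prod_nonneg divide_inverse ennreal_mult mult_ac)
    also have "\<dots> = ennreal (q x / C) * indicator A x * ennreal (\<Prod>l\<in>UNIV. g l x)"
      by (subst nn_integral_cmult) (auto simp: nn_integral_indicator_prod g_nonneg)
    also have "\<dots> = ennreal (q x * (\<Prod>l\<in>UNIV. g l x) / C) * indicator A x"
      using C by (auto split: split_indicator simp: q_nonneg prod_nonneg g_nonneg simp flip: ennreal_mult)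
    finally show "(\<integral>\<^sup>+u. ennreal (1 / C) * (ennreal (joint_density q g x u) * indicator A x) \<partial>L)
        = ennreal (q x * (\<Prod>l\<in>UNIV. g l x) / C) * indicator A x" .
  qed
  also have "\<dots> = emeasure (posterior S q g) A"
    by (simp add: emeasure_posterior[OF A] C_def)
  finally show "emeasure (posterior S q g \<bind> slice_kernel S q g) A = emeasure (posterior S q g) A" .
qed

section \<open>Minorization of the slice kernel\<close>

lemma q_integral_pos: "0 < (\<integral>x. q x \<partial>S)"
proof -
  obtain \<xi> where \<xi>: "\<xi> \<in> space S" using nonempty by blast
  have "0 < mass (\<lambda>l. g l \<xi> / 2)" by (rule slice_pos[OF \<xi>]) (use g_pos in auto)
  also have "\<dots> \<le> (\<integral>x. q x \<partial>S)" by (rule mass_le)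
  finally show ?thesis .
qed

text \<open>The two box indicators multiply to that of their intersection, the box with sides
  \<open>min (g l \<xi>) (g l x)\<close>. Its volume divided by that of the box of \<xi> is compared
  factor by factor with \<open>g l x / G l\<close>.\<close>

lemma slice_kernel_density_ge:
  "ennreal (q x * (\<Prod>l\<in>UNIV. g l x / G l))
    \<le> (\<integral>\<^sup>+u. ennreal (aux_density \<xi> u) * ennreal (joint_density q g x u) \<partial>L)"
proof -
  have "q x * (\<Prod>l\<in>UNIV. g l x / G l) \<le> q x * (\<Prod>l\<in>UNIV. min (g l \<xi>) (g l x) / g l \<xi>)"
  proof (intro mult_left_mono prod_mono conjI q_nonneg)
    fix l
    \<comment> \<open>If the minimum is \<open>g l \<xi>\<close>, the right side is 1; otherwise
      only the denominators differ, and \<open>g l \<xi> \<le> G l\<close>.\<close>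
    show "g l x / G l \<le> min (g l \<xi>) (g l x) / g l \<xi>"
      using g_le[of l x] g_le[of l \<xi>] g_pos[of l \<xi>] g_pos[of l x]
      by (auto simp: min_def intro!: frac_le)
  qed (simp add: g_nonneg G_pos less_imp_le)
  also have "\<dots> = (q x / (\<Prod>l\<in>UNIV. g l \<xi>)) * (\<Prod>l\<in>UNIV. min (g l \<xi>) (g l x))"
    by (simp add: prod_dividef)
  finally have "ennreal (q x * (\<Prod>l\<in>UNIV. g l x / G l))
      \<le> ennreal (q x / (\<Prod>l\<in>UNIV. g l \<xi>)) * ennreal (\<Prod>l\<in>UNIV. min (g l \<xi>) (g l x))"
    by (subst ennreal_mult[symmetric]) (auto simp: q_nonneg prod_nonneg g_nonneg ennreal_leI)
  also have "\<dots> = (\<integral>\<^sup>+u. ennreal (q x / (\<Prod>l\<in>UNIV. g l \<xi>))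
      * ennreal (\<Prod>l\<in>UNIV. indicator {0<..min (g l \<xi>) (g l x)} (u l)) \<partial>L)"
    by (subst nn_integral_cmult) (auto simp: nn_integral_indicator_prod g_nonneg)
  also have "\<dots> = (\<integral>\<^sup>+u. ennreal (aux_density \<xi> u) * ennreal (joint_density q g x u) \<partial>L)"
  proof (intro nn_integral_cong)
    fix u :: "'n \<Rightarrow> real"
    have "(\<Prod>l\<in>UNIV. indicator {0<..min (g l \<xi>) (g l x)} (u l) :: real)
        = (\<Prod>l\<in>UNIV. indicator {0<..g l \<xi>} (u l)) * (\<Prod>l\<in>UNIV. indicator {0<..g l x} (u l))"
      unfolding prod.distrib[symmetric] by (intro prod.cong) (auto split: split_indicator)
    then show "ennreal (q x / (\<Prod>l\<in>UNIV. g l \<xi>))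
        * ennreal (\<Prod>l\<in>UNIV. indicator {0<..min (g l \<xi>) (g l x)} (u l))
      = ennreal (aux_density \<xi> u) * ennreal (joint_density q g x u)"
      using prod_g_pos[of \<xi>]
      by (subst (1 2) ennreal_mult[symmetric])
         (auto simp: joint_density_nonneg aux_density_nonneg q_nonneg prod_nonneg
            joint_density_def prod_dividef)
  qed
  finally show ?thesis .
qed

text \<open>This becomes \<open>h_const\<close> once the \<open>G l\<close> are the suprema and
  \<open>S\<close> is Lebesgue measure on a set outside which \<open>q\<close> vanishes.\<close>

definition minorization_const :: real where
  "minorization_const = (\<integral>x. q x * (\<Prod>l\<in>UNIV. g l x / G l) \<partial>S) / (\<integral>x. q x \<partial>S)"

lemma minorization_integral:
  "(\<integral>x. q x * (\<Prod>l\<in>UNIV. g l x / G l) \<partial>S)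
    = (\<integral>x. q x * (\<Prod>l\<in>UNIV. g l x) \<partial>S) / (\<Prod>l\<in>UNIV. G l)"
  by (simp add: prod_dividef)

lemma minorization_const_pos: "0 < minorization_const"
  unfolding minorization_const_def minorization_integral
  using posterior_constant_pos q_integral_pos G_pos by (simp add: prod_pos)

lemma slice_kernel_minorization:
  assumes A [measurable]: "A \<in> sets S"
  shows "ennreal minorization_const * emeasure (posterior S q g) A
    \<le> emeasure (slice_kernel S q g \<xi>) A"
proof -
  define I where "I = (\<integral>x. q x \<partial>S)"
  have I: "0 < I" using q_integral_pos by (simp add: I_def)
  define C where "C = (\<integral>x. q x * (\<Prod>l\<in>UNIV. g l x) \<partial>S)"
  have C: "0 < C" using posterior_constant_pos by (simp add: C_def)
  have "ennreal minorization_const * emeasure (posterior S q g) A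
      = (\<integral>\<^sup>+x. ennreal minorization_const * (ennreal (q x * (\<Prod>l\<in>UNIV. g l x) / C) * indicator A x) \<partial>S)"
    unfolding emeasure_posterior[OF A] C_def[symmetric] by (intro nn_integral_cmult[symmetric]) measurable
  also have "\<dots> = (\<integral>\<^sup>+x. ennreal (1 / I) * (ennreal (q x * (\<Prod>l\<in>UNIV. g l x / G l)) * indicator A x) \<partial>S)"
  proof (intro nn_integral_cong)
    fix x
    \<comment> \<open>The posterior constant \<open>C\<close> cancels against the numerator of
      \<open>minorization_const\<close>, leaving the lower bound of
      \<open>slice_kernel_density_ge\<close> divided by \<open>I\<close>.\<close>
    have "minorization_const * (q x * (\<Prod>l\<in>UNIV. g l x) / C) = 1 / I * (q x * (\<Prod>l\<in>UNIV. g l x / G l))"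
      using C I unfolding minorization_const_def minorization_integral
      by (simp add: C_def[symmetric] I_def[symmetric] prod_dividef)
    then show "ennreal minorization_const * (ennreal (q x * (\<Prod>l\<in>UNIV. g l x) / C) * indicator A x)
      = ennreal (1 / I) * (ennreal (q x * (\<Prod>l\<in>UNIV. g l x / G l)) * indicator A x)"
      using C I minorization_const_pos
      by (auto split: split_indicator simp: q_nonneg prod_nonneg g_nonneg less_imp_le G_pos
          simp flip: ennreal_mult)
  qed
  also have "\<dots> \<le> (\<integral>\<^sup>+x. \<integral>\<^sup>+u. ennreal (1 / I) * (ennreal (aux_density \<xi> u) * ennreal (joint_density q g x u) * indicator A x) \<partial>L \<partial>S)"
  proof (intro nn_integral_mono)
    fix x
    have "(\<integral>\<^sup>+u. ennreal (1 / I) * (ennreal (aux_density \<xi> u) * ennreal (joint_density q g x u) * indicator A x) \<partial>L)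
       = ennreal (1 / I) * ((\<integral>\<^sup>+u. ennreal (aux_density \<xi> u) * ennreal (joint_density q g x u) \<partial>L) * indicator A x)"
      if "x \<in> space S" using that
      by (subst nn_integral_cmult, measurable, subst nn_integral_multc) auto
    moreover assume "x \<in> space S"
    ultimately show "ennreal (1 / I) * (ennreal (q x * (\<Prod>l\<in>UNIV. g l x / G l)) * indicator A x)
      \<le> (\<integral>\<^sup>+u. ennreal (1 / I) * (ennreal (aux_density \<xi> u) * ennreal (joint_density q g x u) * indicator A x) \<partial>L)"
      using slice_kernel_density_ge[of x \<xi>] by (auto intro!: mult_left_mono mult_right_mono)
  qed
  also have "\<dots> = (\<integral>\<^sup>+u. \<integral>\<^sup>+x. ennreal (1 / I) * (ennreal (aux_density \<xi> u) * ennreal (joint_density q g x u) * indicator A x) \<partial>S \<partial>L)"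
    by (rule SL.Fubini'[symmetric]) measurable
  also have "\<dots> = (\<integral>\<^sup>+u. ennreal (aux_density \<xi> u) * (ennreal (1 / I) * (emeasure (conditional u) A * ennreal (mass u))) \<partial>L)"
  proof (intro nn_integral_cong)
    fix u
    have "(\<integral>\<^sup>+x. ennreal (1 / I) * (ennreal (aux_density \<xi> u) * ennreal (joint_density q g x u) * indicator A x) \<partial>S)
       = (\<integral>\<^sup>+x. (ennreal (aux_density \<xi> u) * ennreal (1 / I)) * (ennreal (joint_density q g x u) * indicator A x) \<partial>S)"
      by (simp add: mult_ac)
    also have "\<dots> = ennreal (aux_density \<xi> u) * (ennreal (1 / I) * (emeasure (conditional u) A * ennreal (mass u)))"
      unfolding emeasure_conditional_mult_mass[OF A]
      by (subst nn_integral_cmult) (auto simp: mult.assoc)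
    finally show "(\<integral>\<^sup>+x. ennreal (1 / I) * (ennreal (aux_density \<xi> u) * ennreal (joint_density q g x u) * indicator A x) \<partial>S)
       = ennreal (aux_density \<xi> u) * (ennreal (1 / I) * (emeasure (conditional u) A * ennreal (mass u)))" .
  qed
  \<comment> \<open>The factor mass u / I is at most 1: the normalization of each slice has been
    replaced by the total integral of \<open>q\<close>, which does not depend on
    \<open>u\<close>.\<close>
  also have "\<dots> \<le> (\<integral>\<^sup>+u. ennreal (aux_density \<xi> u) * emeasure (conditional u) A \<partial>L)"
  proof (intro nn_integral_mono mult_left_mono)
    fix u
    have "ennreal (1 / I) * (emeasure (conditional u) A * ennreal (mass u))
        = emeasure (conditional u) A * ennreal (mass u / I)"
      using I mass_nonneg[of u] by (simp add: divide_inverse ennreal_mult mult_ac)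
    also have "\<dots> \<le> emeasure (conditional u) A * ennreal 1"
      using I mass_le[of u] by (intro mult_left_mono ennreal_leI) (auto simp: I_def)
    finally show "ennreal (1 / I) * (emeasure (conditional u) A * ennreal (mass u)) \<le> emeasure (conditional u) A"
      by simp
  qed simp
  also have "\<dots> = emeasure (slice_kernel S q g \<xi>) A"
    by (rule emeasure_slice_kernel[OF A, symmetric])
  finally show ?thesis .
qed

theorem uniformly_ergodic_slice_kernel:
  assumes "minorization_const < 1"
  shows "uniformly_ergodic S (slice_kernel S q g) (posterior S q g) (1 - minorization_const)"
  by (rule uniformly_ergodic_of_minorization)
     (simp_all add: assms slice_kernel_measurable posterior_in_prob_algebra posterior_invariant
        minorization_const_pos slice_kernel_minorization)

end

subsection \<open>Truncated Gaussian densities\<close>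

lemma AE_lborel_not_hyperplane:
  fixes a :: "'a::euclidean_space"
  assumes "a \<noteq> 0"
  shows "AE x in lborel. a \<bullet> x \<noteq> c"
proof -
  have "{x. a \<bullet> x = c} \<in> sets lborel"
    using closed_hyperplane[of a c] by (simp add: borel_closed)
  moreover have "{x. a \<bullet> x = c} \<in> null_sets lebesgue"
    using negligible_hyperplane[of a c] assms by (simp add: negligible_iff_null_sets)
  ultimately have "{x. a \<bullet> x = c} \<in> null_sets lborel"
    by (simp add: null_sets_def)
  then show ?thesis by (auto dest: AE_not_in)
qed

lemma not_AE_lborel_notin_open:
  fixes T :: "'a::euclidean_space set"
  assumes "open T" "T \<noteq> {}"
  shows "\<not> (AE x in lborel. x \<notin> T)"
proof
  assume "AE x in lborel. x \<notin> T"
  then have "T \<in> null_sets lborel"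
    using assms(1) by (subst AE_iff_null_sets) auto
  then have "negligible T"
    by (simp add: negligible_iff_null_sets null_sets_completionI)
  then show False using open_not_negligible assms by blast
qed

section \<open>Integrability of Gaussian functions\<close>

lemma integrable_exp_minus_square:
  fixes c m :: real
  assumes "0 < c"
  shows "integrable lborel (\<lambda>t. exp (- (c * (t - m)\<^sup>2)))"
proof -
  \<comment> \<open>With variance 1 / (2 c) the exponent of the normal density is exactly -c (t -
    m)^2.\<close>
  define \<sigma> where "\<sigma> = sqrt (1 / (2 * c))"
  have "0 < \<sigma>" using assms by (simp add: \<sigma>_def)
  have s: "\<sigma>\<^sup>2 = 1 / (2 * c)" using assms by (simp add: \<sigma>_def)
  have "exp (- (c * (t - m)\<^sup>2)) = sqrt (2 * pi * \<sigma>\<^sup>2) * normal_density m \<sigma> t" for t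
    using assms unfolding normal_density_def s by (simp add: field_simps)
  then show ?thesis using \<open>0 < \<sigma>\<close> by simp
qed

text \<open>The squared norm is a sum over coordinates, so the integral factorizes into
  one-dimensional Gaussian integrals.\<close>

lemma integrable_exp_minus_norm_square:
  fixes m :: "'a::euclidean_space"
  assumes "0 < c"
  shows "integrable lborel (\<lambda>x. exp (- (c * (norm (x - m))\<^sup>2)))"
proof -
  have "(\<integral>\<^sup>+x. ennreal (norm (exp (- (c * (norm (x - m))\<^sup>2)))) \<partial>lborel)
      = (\<integral>\<^sup>+x. (\<Prod>b\<in>Basis. ennreal (exp (- (c * (x \<bullet> b - m \<bullet> b)\<^sup>2)))) \<partial>lborel)"
  proof (intro nn_integral_cong)
    fix x :: 'a
    have "(norm (x - m))\<^sup>2 = (\<Sum>b\<in>Basis. (x \<bullet> b - m \<bullet> b)\<^sup>2)"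
      unfolding power2_norm_eq_inner
      by (subst euclidean_inner) (simp add: inner_diff_left power2_eq_square)
    then show "ennreal (norm (exp (- (c * (norm (x - m))\<^sup>2))))
        = (\<Prod>b\<in>Basis. ennreal (exp (- (c * (x \<bullet> b - m \<bullet> b)\<^sup>2))))"
      by (simp add: prod_ennreal sum_distrib_left exp_sum abs_prod flip: sum_negf)
  qed
  also have "\<dots> = (\<Prod>b\<in>(Basis :: 'a set). \<integral>\<^sup>+t. ennreal (exp (- (c * (t - m \<bullet> b)\<^sup>2))) \<partial>lborel)"
    by (rule nn_integral_lborel_prod) auto
  also have "\<dots> < \<infinity>"
    using integrable_exp_minus_square[OF assms]
    by (simp add: nn_integral_eq_integral prod_ennreal)
  finally show ?thesis by (intro integrableI_bounded) auto
qed

text \<open>The quadratic form of the inverse is continuous and positive, so it has a positive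
  minimum on the compact unit sphere; homogeneity of degree 2 extends the bound to all vectors. This
  is what bounds \<open>q_factor\<close> by an isotropic Gaussian.\<close>

lemma pos_def_matrix_inv_coercive:
  fixes A :: "real^'p^'p"
  assumes "pos_def_matrix A"
  obtains c where "0 < c" "\<And>v. c * (norm v)\<^sup>2 \<le> v \<bullet> (matrix_inv A *v v)"
proof -
  have pos: "0 < v \<bullet> (A *v v)" if "v \<noteq> 0" for v
    using assms that by (simp add: pos_def_matrix_def)
  have "\<forall>v. A *v v = 0 \<longrightarrow> v = 0"
    using pos by (metis inner_zero_right less_irrefl)
  \<comment> \<open>\<open>matrix_inv\<close> is defined by a choice, so it is an inverse only after
    invertibility is known; here the kernel of \<open>A\<close> is trivial by positivity.\<close>
  then have "invertible A"
    by (simp add: invertible_left_inverse matrix_left_invertible_ker)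
  then have inv: "A ** matrix_inv A = mat 1"
    unfolding invertible_def matrix_inv_def by (rule someI2_ex) simp
  let ?B = "\<lambda>v. matrix_inv A *v v"
  have AB: "A *v ?B v = v" for v
    by (simp add: matrix_vector_mul_assoc inv)
  \<comment> \<open>Since v = A (B v), the form of the inverse at v is the form of \<open>A\<close>
    at B v.\<close>
  have Bpos: "0 < v \<bullet> ?B v" if "v \<noteq> 0" for v
  proof -
    have "?B v \<noteq> 0" using AB[of v] that by (metis matrix_vector_mult_0_right)
    from pos[OF this] show ?thesis by (simp add: AB inner_commute)
  qed
  have "continuous_on (sphere 0 1) (\<lambda>v. v \<bullet> ?B v)"
    by (intro continuous_intros matrix_vector_mult_linear_continuous_on)
  moreover have "sphere (0 :: real^'p) 1 \<noteq> {}" by simp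
  ultimately obtain w where w: "w \<in> sphere 0 1" "\<And>v. v \<in> sphere 0 1 \<Longrightarrow> w \<bullet> ?B w \<le> v \<bullet> ?B v"
    using continuous_attains_inf[of "sphere (0 :: real^'p) 1" "\<lambda>v. v \<bullet> ?B v"] by auto
  show thesis
  proof
    show "0 < w \<bullet> ?B w" using w(1) by (intro Bpos) auto
    fix v :: "real^'p"
    show "(w \<bullet> ?B w) * (norm v)\<^sup>2 \<le> v \<bullet> ?B v"
    proof (cases "v = 0")
      case False
      define e where "e = v /\<^sub>R norm v"
      have "v = norm v *\<^sub>R e" using False by (simp add: e_def)
      then have "v \<bullet> ?B v = (norm v)\<^sup>2 * (e \<bullet> ?B e)"
        by (metis inner_scaleR_left inner_scaleR_right matrix_vector_mult_scaleR mult.assoc power2_eq_square)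
      moreover have "w \<bullet> ?B w \<le> e \<bullet> ?B e" using False by (intro w(2)) (simp add: e_def)
      ultimately show ?thesis by (simp add: mult.commute[of "(norm v)\<^sup>2"] mult_right_mono)
    qed simp
  qed
qed

section \<open>The feasible polyhedron and the truncated Gaussian factor\<close>

lemma feasible_set_inner: "feasible_set R b = (\<Inter>i. {\<beta>. R $ i \<bullet> \<beta> \<ge> b $ i})"
  by (auto simp: feasible_set_def matrix_vector_mul_component)

lemma closed_feasible_set: "closed (feasible_set R b)"
  unfolding feasible_set_inner by (intro closed_INT ballI closed_halfspace_ge)

lemma convex_feasible_set: "convex (feasible_set R b)"
  unfolding feasible_set_inner by (intro convex_INT convex_halfspace_ge)

lemma feasible_set_measurable [measurable]: "feasible_set R b \<in> sets borel"
  by (intro borel_closed closed_feasible_set)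

lemma q_factor_measurable [measurable]: "q_factor X y \<mu>1 \<Sigma>1 R b \<in> borel_measurable borel"
proof -
  have "continuous_on UNIV (\<lambda>\<beta>. exp (y \<bullet> (X *v \<beta>)
      - 1 / 2 * ((\<beta> - \<mu>1) \<bullet> (matrix_inv \<Sigma>1 *v (\<beta> - \<mu>1)))))"
    by (intro continuous_intros bounded_linear.continuous_on[OF matrix_vector_mul_bounded_linear])
  then have [measurable]: "(\<lambda>\<beta>. exp (y \<bullet> (X *v \<beta>)
      - 1 / 2 * ((\<beta> - \<mu>1) \<bullet> (matrix_inv \<Sigma>1 *v (\<beta> - \<mu>1))))) \<in> borel_measurable borel"
    by (rule borel_measurable_continuous_onI)
  show ?thesis unfolding q_factor_def by measurable
qed

lemma q_factor_nonneg: "0 \<le> q_factor X y \<mu>1 \<Sigma>1 R b \<beta>"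
  by (simp add: q_factor_def)

lemma q_factor_pos: "\<beta> \<in> feasible_set R b \<Longrightarrow> 0 < q_factor X y \<mu>1 \<Sigma>1 R b \<beta>"
  by (simp add: q_factor_def)

lemma q_factor_outside: "\<beta> \<notin> feasible_set R b \<Longrightarrow> q_factor X y \<mu>1 \<Sigma>1 R b \<beta> = 0"
  by (simp add: q_factor_def)

text \<open>Around \<mu>1 the linear term grows at most like K times the norm, and half of the
  coercive quadratic term absorbs it. What remains is a centred Gaussian with coefficient c /
  4.\<close>

lemma q_factor_integrable:
  assumes "pos_def_matrix \<Sigma>1"
  shows "integrable lborel (q_factor X y \<mu>1 \<Sigma>1 R b)"
proof -
  obtain c where c: "0 < c" "\<And>v. c * (norm v)\<^sup>2 \<le> v \<bullet> (matrix_inv \<Sigma>1 *v v)"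
    using pos_def_matrix_inv_coercive[OF assms] by blast
  have "bounded_linear (\<lambda>w. y \<bullet> (X *v w))"
    by (intro bounded_linear_compose[OF bounded_linear_inner_right] matrix_vector_mul_bounded_linear)
  then obtain K where K: "\<And>w. \<bar>y \<bullet> (X *v w)\<bar> \<le> norm w * K"
    using bounded_linear.bounded by fastforce
  define E where "E = exp (y \<bullet> (X *v \<mu>1) + K\<^sup>2 / c)"
  have bound: "q_factor X y \<mu>1 \<Sigma>1 R b \<beta> \<le> E * exp (- (c / 4 * (norm (\<beta> - \<mu>1))\<^sup>2))" for \<beta>
  proof -
    define w where "w = \<beta> - \<mu>1"
    have "y \<bullet> (X *v \<beta>) = y \<bullet> (X *v \<mu>1) + y \<bullet> (X *v w)"
      by (simp add: w_def matrix_vector_mult_diff_distrib inner_diff_right)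
    moreover have "y \<bullet> (X *v w) \<le> norm w * K" using K[of w] by linarith
    moreover have "norm w * K \<le> K\<^sup>2 / c + c / 4 * (norm w)\<^sup>2"
    proof -
      \<comment> \<open>This square is chosen so that its cross term is exactly K times the norm of
        \<open>w\<close>.\<close>
      have "0 \<le> (K - c / 2 * norm w)\<^sup>2 / c" using c by simp
      also have "\<dots> = K\<^sup>2 / c + c / 4 * (norm w)\<^sup>2 - norm w * K"
        using c by (simp add: power2_eq_square field_simps)
      finally show ?thesis by simp
    qed
    ultimately have "y \<bullet> (X *v \<beta>) - 1 / 2 * (w \<bullet> (matrix_inv \<Sigma>1 *v w))
        \<le> y \<bullet> (X *v \<mu>1) + K\<^sup>2 / c + - (c / 4 * (norm w)\<^sup>2)"
      using c(2)[of w] by simp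
    then show ?thesis
      unfolding q_factor_def E_def exp_add[symmetric] w_def
      by (auto split: split_indicator)
  qed
  have "integrable lborel (\<lambda>\<beta>. E * exp (- (c / 4 * (norm (\<beta> - \<mu>1))\<^sup>2)))"
    using c by (intro integrable_mult_right integrable_exp_minus_norm_square) simp
  then show ?thesis
    by (rule Bochner_Integration.integrable_bound)
       (auto simp: q_factor_nonneg intro!: AE_I2 order_trans[OF bound] )
qed

section \<open>The slice factors and their maximizers\<close>

lemma g_factor_pos: "0 < g_factor \<Psi> X l \<beta>"
  by (simp add: g_factor_def)

lemma g_factor_continuous:
  assumes "continuous_on UNIV \<Psi>"
  shows "continuous_on UNIV (g_factor \<Psi> X l)"
  unfolding g_factor_def
  by (intro continuous_intros continuous_on_compose2[OF assms]) auto

lemma g_factor_le_Sup: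
  assumes "\<And>v. 0 \<le> \<Psi> v"
  shows "g_factor \<Psi> X l \<beta> \<le> (SUP \<beta>'. g_factor \<Psi> X l \<beta>')"
  by (rule cSUP_upper) (auto intro!: bdd_aboveI[of _ 1] simp: g_factor_def assms)

text \<open>Minimizers are zeros of the first derivative, and a positive second derivative makes the
  first one strictly increasing, hence injective.\<close>

lemma argmin_unique:
  fixes \<Psi> :: "real \<Rightarrow> real"
  assumes "\<And>v. \<Psi> differentiable (at v)" "\<And>v. deriv \<Psi> differentiable (at v)"
    and "\<And>v. 0 < deriv (deriv \<Psi>) v"
    and "\<And>w. \<Psi> u \<le> \<Psi> w" "\<And>w. \<Psi> v \<le> \<Psi> w"
  shows "u = v"
proof -
  have D: "(\<Psi> has_real_derivative deriv \<Psi> v) (at v)" for v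
    using assms(1) by (simp add: DERIV_deriv_iff_real_differentiable)
  have DD: "(deriv \<Psi> has_real_derivative deriv (deriv \<Psi>) v) (at v)" for v
    using assms(2) by (simp add: DERIV_deriv_iff_real_differentiable)
  have crit: "deriv \<Psi> u = 0" "deriv \<Psi> v = 0"
    using DERIV_local_min[OF D, of 1] assms(4,5) by auto
  have "deriv \<Psi> a < deriv \<Psi> b" if "a < b" for a b
    using that by (rule DERIV_pos_imp_increasing) (use DD assms(3) in blast)
  from this[of u v] this[of v u] crit show ?thesis by (metis less_irrefl linorder_neqE)
qed

text \<open>A nonzero row gives a linear form onto the reals, so maximizing the factor over all
  vectors amounts to minimizing \<Psi> over the whole line. The vector \<open>\<beta>'\<close> is
  the multiple of the row at which the form takes the value \<open>w\<close>.\<close>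

lemma g_factor_argmax:
  assumes nonneg: "\<And>v. 0 \<le> \<Psi> v" and l: "row l X \<noteq> 0"
    and max: "g_factor \<Psi> X l \<beta> = (SUP \<beta>'. g_factor \<Psi> X l \<beta>')"
  shows "\<Psi> (row l X \<bullet> \<beta>) \<le> \<Psi> w"
proof -
  define \<beta>' where "\<beta>' = (w / (row l X \<bullet> row l X)) *\<^sub>R row l X"
  have "row l X \<bullet> \<beta>' = w" using l by (simp add: \<beta>'_def)
  moreover have "g_factor \<Psi> X l \<beta>' \<le> g_factor \<Psi> X l \<beta>"
    unfolding max using nonneg by (rule g_factor_le_Sup)
  ultimately show ?thesis by (simp add: g_factor_def)
qed

text \<open>A convex set of positive measure has interior points, and they are dense in it. The open
  set \<open>U\<close> contains the feasible point \<xi>, so it meets this interior in a nonempty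
  open set, on which the joint density is positive.\<close>

lemma slice_mass_pos:
  assumes \<Psi>: "continuous_on UNIV \<Psi>" and \<Sigma>1: "pos_def_matrix \<Sigma>1"
    and pos: "0 < emeasure lborel (feasible_set R b)"
    and \<xi>: "\<xi> \<in> feasible_set R b" and u: "\<And>l. 0 < u l \<and> u l < g_factor \<Psi> X l \<xi>"
  shows "0 < (\<integral>\<beta>. joint_density (q_factor X y \<mu>1 \<Sigma>1 R b) (g_factor \<Psi> X) \<beta> u
    \<partial>restrict_space lborel (feasible_set R b))"
proof -
  let ?\<Omega> = "feasible_set R b"
  define q where "q = q_factor X y \<mu>1 \<Sigma>1 R b"
  \<comment> \<open>Strict inequalities make \<open>U\<close> open by continuity; it lies inside the
    closed slice that carries the joint density.\<close>
  define U where "U = {\<beta>. \<forall>l. u l < g_factor \<Psi> X l \<beta>}"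
  have "open U"
  proof -
    have "U = (\<Inter>l. {\<beta>. u l < g_factor \<Psi> X l \<beta>})" by (auto simp: U_def)
    then show ?thesis
      by (auto intro!: open_INT open_Collect_less g_factor_continuous \<Psi> continuous_intros)
  qed
  have [measurable]: "U \<in> sets borel" using \<open>open U\<close> by simp
  have "\<not> negligible ?\<Omega>"
    using pos by (auto simp: negligible_iff_null_sets null_sets_def)
  then have "interior ?\<Omega> \<noteq> {}"
    using negligible_convex_interior[OF convex_feasible_set] by blast
  then have "\<xi> \<in> closure (interior ?\<Omega>)"
    using convex_closure_interior[OF convex_feasible_set] \<xi> closure_subset by blast
  moreover have "\<xi> \<in> U" using u by (simp add: U_def)
  ultimately have ne: "U \<inter> interior ?\<Omega> \<noteq> {}"
    using open_Int_closure_eq_empty[OF \<open>open U\<close>] by blast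
  \<comment> \<open>The integral over the restricted space is the integral of \<open>f\<close> over
    the whole space.\<close>
  define f where "f \<beta> = indicator ?\<Omega> \<beta> * joint_density q (g_factor \<Psi> X) \<beta> u" for \<beta>
  have f_eq: "f \<beta> = q \<beta> * indicator {\<beta>'. \<forall>l. u l \<le> g_factor \<Psi> X l \<beta>'} \<beta>" for \<beta>
    using u by (auto simp: f_def q_def joint_density_pos q_factor_outside split: split_indicator)
  have f_nonneg: "0 \<le> f \<beta>" for \<beta> by (simp add: f_eq q_def q_factor_nonneg)
  have "closed {\<beta>'. \<forall>l. u l \<le> g_factor \<Psi> X l \<beta>'}"
    by (intro closed_Collect_all closed_Collect_le g_factor_continuous \<Psi> continuous_intros)
  then have f_int: "integrable lborel f"
    unfolding f_eq q_def
    by (intro integrable_real_mult_indicator q_factor_integrable \<Sigma>1) (simp add: borel_closed)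
  have "\<not> (AE \<beta> in lborel. f \<beta> = 0)"
  proof
    assume "AE \<beta> in lborel. f \<beta> = 0"
    then have "AE \<beta> in lborel. \<beta> \<notin> U \<inter> interior ?\<Omega>"
    proof eventually_elim
      case (elim \<beta>)
      show ?case
      proof
        assume "\<beta> \<in> U \<inter> interior ?\<Omega>"
        then have "\<beta> \<in> ?\<Omega>" "\<forall>l. u l \<le> g_factor \<Psi> X l \<beta>"
          using interior_subset by (auto simp: U_def less_imp_le)
        then have "f \<beta> = q \<beta>" "0 < q \<beta>" by (auto simp: f_eq q_def q_factor_pos)
        with elim show False by simp
      qed
    qed
    then show False
      using not_AE_lborel_notin_open ne \<open>open U\<close> by (metis open_Int open_interior)
  qed
  then have "0 < (\<integral>\<beta>. f \<beta> \<partial>lborel)"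
    using integral_nonneg_eq_0_iff_AE[OF f_int] f_nonneg
    by (simp add: order_less_le)
  then show ?thesis
    by (subst integral_restrict_space) (simp_all add: f_def q_def)
qed

lemma h_const_less_1:
  assumes X: "X \<noteq> 0" and \<Sigma>1: "pos_def_matrix \<Sigma>1"
    and pos: "0 < emeasure lborel (feasible_set R b)"
    and diff: "\<And>v. \<Psi> differentiable (at v)" "\<And>v. deriv \<Psi> differentiable (at v)"
      "\<And>v. 0 < deriv (deriv \<Psi>) v"
    and nonneg: "\<And>v. 0 \<le> \<Psi> v"
  shows "h_const (q_factor X y \<mu>1 \<Sigma>1 R b) (g_factor \<Psi> X) < 1"
proof -
  let ?\<Omega> = "feasible_set R b"
  define q where "q = q_factor X y \<mu>1 \<Sigma>1 R b"
  define G where "G l = (SUP \<beta>. g_factor \<Psi> X l \<beta>)" for l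
  define F where "F \<beta> = (\<Prod>l\<in>UNIV. g_factor \<Psi> X l \<beta> / G l)" for \<beta>
  have q_int: "integrable lborel q" unfolding q_def by (rule q_factor_integrable[OF \<Sigma>1])
  have le: "g_factor \<Psi> X l \<beta> \<le> G l" for l \<beta>
    unfolding G_def using nonneg by (rule g_factor_le_Sup)
  have G_pos: "0 < G l" for l
    using le[of l 0] g_factor_pos[of \<Psi> X l 0] by linarith
  have ratio: "0 < g_factor \<Psi> X l \<beta> / G l" "g_factor \<Psi> X l \<beta> / G l \<le> 1" for l \<beta>
    using le G_pos g_factor_pos by (auto simp: divide_le_eq_1 intro!: divide_pos_pos)
  have F: "0 < F \<beta>" "F \<beta> \<le> 1" for \<beta>
    unfolding F_def using ratio by (auto intro!: prod_pos prod_le_1 simp: less_imp_le)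
  have "continuous_on UNIV \<Psi>"
    using diff(1) by (simp add: continuous_at_imp_continuous_on differentiable_imp_continuous_within)
  then have [measurable]: "g_factor \<Psi> X l \<in> borel_measurable borel" for l
    by (intro borel_measurable_continuous_onI g_factor_continuous)
  have F_meas [measurable]: "F \<in> borel_measurable borel" unfolding F_def by measurable
  have qF_int: "integrable lborel (\<lambda>\<beta>. q \<beta> * F \<beta>)"
  proof (rule Bochner_Integration.integrable_bound[OF q_int])
    show "(\<lambda>\<beta>. q \<beta> * F \<beta>) \<in> borel_measurable lborel" unfolding q_def by measurable
    show "AE \<beta> in lborel. norm (q \<beta> * F \<beta>) \<le> norm (q \<beta>)"
      using F by (auto intro!: AE_I2 mult_right_le_one_le simp: abs_mult less_imp_le)
  qed
  obtain l where l: "row l X \<noteq> 0"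
    using X by (metis row_def vec_eq_iff vec_lambda_eta zero_index)
  have argmax: "row l X \<bullet> \<beta> = row l X \<bullet> \<beta>'" if "F \<beta> = 1" "F \<beta>' = 1" for \<beta> \<beta>'
  proof -
    \<comment> \<open>All ratios are at most 1, so a product equal to 1 forces the ratio at
      \<open>l\<close> to be 1.\<close>
    have "g_factor \<Psi> X l \<beta> = G l" if "F \<beta> = 1" for \<beta>
    proof -
      have "F \<beta> = g_factor \<Psi> X l \<beta> / G l * (\<Prod>l\<in>UNIV - {l}. g_factor \<Psi> X l \<beta> / G l)"
        unfolding F_def by (rule prod.remove) auto
      also have "\<dots> \<le> g_factor \<Psi> X l \<beta> / G l"
        using ratio by (intro mult_right_le_one_le prod_le_1 prod_nonneg) (auto simp: less_imp_le)
      finally show ?thesis using that le[of l \<beta>] G_pos[of l] by simp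
    qed
    then have "\<Psi> (row l X \<bullet> \<beta>) \<le> \<Psi> w" if "F \<beta> = 1" for \<beta> w
      using that unfolding G_def by (intro g_factor_argmax[OF nonneg l]) simp
    then show ?thesis
      using that by (intro argmin_unique[OF diff]) simp_all
  qed
  have not_AE: "\<not> (AE \<beta> in lborel. \<beta> \<notin> ?\<Omega>)"
  proof
    assume "AE \<beta> in lborel. \<beta> \<notin> ?\<Omega>"
    then have "?\<Omega> \<in> null_sets lborel" by (subst AE_iff_null_sets) auto
    with pos show False by (simp add: null_sets_def)
  qed
  \<comment> \<open>The nonnegative difference of the two integrands must be positive on a set of
    positive measure for the integrals to differ strictly.\<close>
  have "\<not> (AE \<beta> in lborel. q \<beta> - q \<beta> * F \<beta> = 0)"
  proof
    assume AE: "AE \<beta> in lborel. q \<beta> - q \<beta> * F \<beta> = 0"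
    \<comment> \<open>If \<open>F\<close> never reaches 1, any \<open>c\<close> will do, so no
      maximizer has to exist.\<close>
    have "\<exists>c. \<forall>\<beta>. F \<beta> = 1 \<longrightarrow> row l X \<bullet> \<beta> = c" using argmax by metis
    then obtain c where c: "\<And>\<beta>. F \<beta> = 1 \<Longrightarrow> row l X \<bullet> \<beta> = c" by blast
    from AE AE_lborel_not_hyperplane[OF l, of c] have "AE \<beta> in lborel. \<beta> \<notin> ?\<Omega>"
    proof eventually_elim
      \<comment> \<open>Off the hyperplane \<open>F\<close> differs from 1, so the vanishing
        difference forces \<open>q \<beta> = 0\<close>, that is, an infeasible point.\<close>
      case (elim \<beta>)
      then have "q \<beta> = 0" using c[of \<beta>] by auto
      then show ?case using q_factor_pos[of \<beta> R b X y \<mu>1 \<Sigma>1] by (auto simp: q_def)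
    qed
    with not_AE show False by blast
  qed
  moreover have "0 \<le> q \<beta> - q \<beta> * F \<beta>" for \<beta>
    using F[of \<beta>] by (simp add: q_def q_factor_nonneg mult_right_le_one_le less_imp_le)
  ultimately have "0 < (\<integral>\<beta>. q \<beta> - q \<beta> * F \<beta> \<partial>lborel)"
    using integral_nonneg_eq_0_iff_AE[of lborel "\<lambda>\<beta>. q \<beta> - q \<beta> * F \<beta>"] q_int qF_int
      integral_mono[OF qF_int q_int]
    by (simp add: order_less_le)
  then have less: "(\<integral>\<beta>. q \<beta> * F \<beta> \<partial>lborel) < (\<integral>\<beta>. q \<beta> \<partial>lborel)"
    using q_int qF_int by simp
  \<comment> \<open>Together with the strict inequality this makes the denominator positive, so the
    quotient is below 1.\<close>
  moreover have "0 \<le> (\<integral>\<beta>. q \<beta> * F \<beta> \<partial>lborel)"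
    using F by (intro Bochner_Integration.integral_nonneg mult_nonneg_nonneg) (auto simp: q_def q_factor_nonneg less_imp_le)
  ultimately have "(\<integral>\<beta>. q \<beta> * F \<beta> \<partial>lborel) / (\<integral>\<beta>. q \<beta> \<partial>lborel) < 1" by simp
  then show ?thesis by (simp add: h_const_def F_def G_def q_def)
qed

section \<open>The product slice sampler on the feasible polyhedron\<close>

theorem theorem1:
  fixes X :: "real^'p^'n" and y :: "real^'n" and \<mu>1 :: "real^'p" and \<Sigma>1 :: "real^'p^'p"
    and R :: "real^'p^'m" and b :: "real^'m" and \<Psi> :: "real \<Rightarrow> real"
  assumes "X \<noteq> 0"
    and "pos_def_matrix \<Sigma>1"
    and "0 < emeasure lborel (feasible_set R b)"
    and "convex_on UNIV \<Psi>"
    and "\<And>v. \<Psi> differentiable (at v)"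
    and "\<And>v. deriv \<Psi> differentiable (at v)"
    and "\<And>v. 0 < deriv (deriv \<Psi>) v"
    and "\<And>v. 0 \<le> \<Psi> v"
  shows "let q = q_factor X y \<mu>1 \<Sigma>1 R b;
             g = g_factor \<Psi> X;
             S = restrict_space lborel (feasible_set R b);
             h = h_const q g
         in h < 1 \<and> (\<exists>r. r \<le> 1 - h \<and> uniformly_ergodic S (slice_kernel S q g) (posterior S q g) r)"
proof -
  let ?\<Omega> = "feasible_set R b"
  define q where "q = q_factor X y \<mu>1 \<Sigma>1 R b"
  define S where "S = restrict_space lborel ?\<Omega>"
  \<comment> \<open>The suprema range over the whole space, as in \<open>h_const\<close>, and not
    only over the feasible set.\<close>
  define G where "G l = (SUP \<beta>. g_factor \<Psi> X l \<beta>)" for l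
  have cont: "continuous_on UNIV \<Psi>"
    using assms(5) by (simp add: continuous_at_imp_continuous_on differentiable_imp_continuous_within)
  have \<Omega>: "?\<Omega> \<inter> space lborel \<in> sets lborel" by simp
  \<comment> \<open>Since \<open>q\<close> already vanishes off the feasible set, integrals over
    \<open>S\<close> and over the whole space agree, which identifies
    \<open>minorization_const\<close> with \<open>h_const\<close>.\<close>
  have q_indicator: "indicator ?\<Omega> \<beta> * (q \<beta> * c) = q \<beta> * c" for \<beta> c
    by (auto simp: q_def q_factor_outside split: split_indicator)
  interpret slice_sampler S q "g_factor \<Psi> X" G
  proof (intro slice_sampler.intro slice_sampler_axioms.intro)
    show "sigma_finite_measure S"
      unfolding S_def by (rule sigma_finite_measure_restrict_space) (simp_all add: sigma_finite_lborel)
    show "space S \<noteq> {}"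
      using assms(3) by (auto simp: S_def space_restrict_space)
    show "integrable S q"
      using q_factor_integrable[OF assms(2), of X y \<mu>1 R b]
      unfolding S_def integrable_restrict_space[OF \<Omega>] q_def[symmetric]
      by (simp only: real_scaleR_def q_indicator[of _ 1, simplified mult_1_right])
    show "g_factor \<Psi> X l \<in> borel_measurable S" for l
      unfolding S_def
      by (intro measurable_restrict_space1)
         (simp add: borel_measurable_continuous_onI g_factor_continuous cont)
    show "g_factor \<Psi> X l \<beta> \<le> G l" for l \<beta>
      unfolding G_def using assms(8) by (rule g_factor_le_Sup)
    show "0 < (\<integral>\<beta>. joint_density q (g_factor \<Psi> X) \<beta> u \<partial>S)"
      if "\<xi> \<in> space S" "\<And>l. 0 < u l \<and> u l < g_factor \<Psi> X l \<xi>" for \<xi> u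
      unfolding S_def q_def
      by (rule slice_mass_pos[OF cont assms(2,3)]) (use that in \<open>auto simp: S_def space_restrict_space\<close>)
  qed (simp_all add: q_def q_factor_nonneg g_factor_pos)
  have "minorization_const = h_const q (g_factor \<Psi> X)"
    unfolding minorization_const_def h_const_def G_def[symmetric]
    unfolding S_def integral_restrict_space[OF \<Omega>] real_scaleR_def
    by (simp only: q_indicator q_indicator[of _ 1, simplified mult_1_right])
  moreover have "h_const q (g_factor \<Psi> X) < 1"
    unfolding q_def using assms by (intro h_const_less_1) auto
  \<comment> \<open>The rate is the extreme value r = 1 - h.\<close>
  ultimately show ?thesis
    using uniformly_ergodic_slice_kernel by (auto simp: Let_def q_def S_def)
qed

end
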